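(* Let $X$ be a real Hilbert space, let $m\in\{2,3,\dots\}$, let $A_1,\dots,A_m: X\rightrightarrows X$ be maximally monotone operators, and suppose that $\mathbf A=A_1\times\cdots\times A_m$ is maximally monotone on $\mathbf X=X^m$ with $\operatorname{zer}\mathbf A\neq\varnothing$. Let $\mathbf Z=\operatorname{psol}(\mathbf A,\mathbf{Id}-\mathbf R)$, and recall that $\operatorname{dsol}(\mathbf A,\mathbf{Id}-\mathbf R)=\operatorname{zer}\left(\mathbf A^{-1}+N_{\mathbf D^\perp}+\tfrac12\mathbf{Id}+\mathbf T\right)$. Then $$\operatorname{dsol}(\mathbf A,\mathbf{Id}-\mathbf R)=(\mathbf R-\mathbf{Id})\mathbf Z=\begin{cases}\left\{\mathbf J_{2(\mathbf A^{-1}+N_{\mathbf D^\perp}+\mathbf T)}(\mathbf 0)\right\},&\text{if }\mathbf Z\neq\varnothing;\\ \varnothing,&\text{if }\mathbf Z=\varnothing.\end{cases}$$ Moreover, if $\mathbf y^*:=\mathbf J_{2(\mathbf A^{-1}+N_{\mathbf D^\perp}+\mathbf T)}(\mathbf 0)$ exists, then the following hold: (1) $\mathbf y^*\in\mathbf D^\perp$. (2) $\mathbf y^*$ is the only vector $\mathbf y$ that makes $\mathbf A^{-1}\mathbf y\cap-\left(N_{\mathbf D^\perp}\mathbf y+\tfrac12\mathbf y+\mathbf T\mathbf y\right)$ nonempty. (3) $\mathbf Z=\mathbf A^{-1}\mathbf y^*\cap\left(-\tfrac12\mathbf y^*-\mathbf T\mathbf y^*-\mathbf D\right)$.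
   Context: $\mathbf X=X^m$ is the Hilbert product space with identity $\mathbf{Id}$. $\mathbf R:\mathbf X\to\mathbf X:(x_1,\dots,x_m)\mapsto(x_m,x_1,\dots,x_{m-1})$ is the circular right-shift operator. $\mathbf D=\{(x,x,\dots,x)\mid x\in X\}$ is the diagonal of $\mathbf X$, $\mathbf D^\perp$ its orthogonal complement, and $N_{\mathbf D^\perp}$ the normal cone operator of $\mathbf D^\perp$ (so $N_{\mathbf D^\perp}\mathbf y=\mathbf D$ if $\mathbf y\in\mathbf D^\perp$ and $\varnothing$ otherwise). $\mathbf T:=\frac1{2m}\sum_{k=1}^{m-1}(m-2k)\mathbf R^k$, so that, as set-valued operators, $(\mathbf{Id}-\mathbf R)^{-1}=\tfrac12\mathbf{Id}+\mathbf T+N_{\mathbf D^\perp}$. For a set-valued operator $\mathbf B$: $\mathbf B^{-1}$ is its set-valued inverse, $\operatorname{zer}\mathbf B=\{\mathbf x\mid\mathbf 0\in\mathbf B\mathbf x\}$, and $\mathbf J_{\mathbf B}=(\mathbf{Id}+\mathbf B)^{-1}$ is its resolvent (here "$\mathbf J_{\mathbf B}(\mathbf 0)$ exists" means that $\mathbf 0$ is in the domain of $\mathbf J_{\mathbf B}$). Attouch--Théra duality: for operators $A,B$, $\operatorname{psol}(A,B)=\{x\mid 0\in Ax+Bx\}$ is the set of primal solutions and $\operatorname{dsol}(A,B)=\{y\mid 0\in A^{-1}y+\left((-\mathrm{Id})\circ B^{-1}\circ(-\mathrm{Id})\right)y\}=\{y\mid 0\in A^{-1}y-B^{-1}(-y)\}$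 the set of dual solutions. By definition $\mathbf Z:=\operatorname{Fix}(\mathbf J_{\mathbf A}\mathbf R)$, which equals $\operatorname{psol}(\mathbf A,\mathbf{Id}-\mathbf R)$. *)

theory Defs
  imports "HOL-Analysis.Analysis"
begin

text \<open>
  A real Hilbert space is a type of sort \<open>{real_inner, complete_space}\<close>, and a set-valued
  operator on it is a function of type \<open>'b \<Rightarrow> 'b set\<close>.
\<close>

subsection \<open>Set-valued operators\<close>

type_synonym 'b setop = "'b \<Rightarrow> 'b set"

definition op_single :: "('b \<Rightarrow> 'b) \<Rightarrow> 'b setop"
  where "op_single f = (\<lambda>x. {f x})"

definition op_comp :: "'b setop \<Rightarrow> 'b setop \<Rightarrow> 'b setop"  (infixl \<open>\<circ>\<^sub>o\<close> 75)
  where "A \<circ>\<^sub>o B = (\<lambda>x. \<Union>y\<in>B x. A y)"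

definition op_inv :: "'b setop \<Rightarrow> 'b setop"
  where "op_inv A = (\<lambda>u. {x. u \<in> A x})"

text \<open>On the right-hand side, \<open>+\<close> is the Minkowski sum of \<open>HOL-Library.Set_Algebras\<close>.\<close>

definition op_add :: "'b::plus setop \<Rightarrow> 'b setop \<Rightarrow> 'b setop"  (infixl \<open>+\<^sub>o\<close> 65)
  where "A +\<^sub>o B = (\<lambda>x. A x + B x)"

definition op_scale :: "real \<Rightarrow> 'b::real_vector setop \<Rightarrow> 'b setop"  (infixr \<open>*\<^sub>o\<close> 70)
  where "c *\<^sub>o A = (\<lambda>x. (\<lambda>u. c *\<^sub>R u) ` A x)"

definition zer :: "'b::zero setop \<Rightarrow> 'b set"
  where "zer A = {x. 0 \<in> A x}"

definition resolvent :: "'b::plus setop \<Rightarrow> 'b setop"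
  where "resolvent B = op_inv (op_single id +\<^sub>o B)"

definition monotone_op :: "'b::real_inner setop \<Rightarrow> bool"
  where "monotone_op A \<longleftrightarrow>
    (\<forall>x y. \<forall>u\<in>A x. \<forall>v\<in>A y. (x - y) \<bullet> (u - v) \<ge> 0)"

definition maximally_monotone :: "'b::real_inner setop \<Rightarrow> bool"
  where "maximally_monotone A \<longleftrightarrow> monotone_op A \<and>
    (\<forall>B. monotone_op B \<and> (\<forall>x. A x \<subseteq> B x) \<longrightarrow> B = A)"

definition normal_cone :: "'b::real_inner set \<Rightarrow> 'b setop"
  where "normal_cone C = (\<lambda>x. if x \<in> C then {u. \<forall>c\<in>C. (c - x) \<bullet> u \<le> 0} else {})"

subsection \<open>Attouch--Thera duality\<close>

definition psol :: "'b::{zero,plus} setop \<Rightarrow> 'b setop \<Rightarrow> 'b set"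
  where "psol A B = {x. 0 \<in> (A +\<^sub>o B) x}"

definition dsol :: "'b::ab_group_add setop \<Rightarrow> 'b setop \<Rightarrow> 'b set"
  where "dsol A B =
    {y. 0 \<in> (op_inv A +\<^sub>o (op_single uminus \<circ>\<^sub>o op_inv B \<circ>\<^sub>o op_single uminus)) y}"

subsection \<open>The product space\<close>

text \<open>
  The product space \<open>X\<^sup>m\<close> is \<open>'a ^ 'm\<close> with its library inner product, where the index type
  \<open>'m\<close> is a finite linear order with \<open>CARD('m) = m\<close>; its elements, in increasing order, play
  the role of \<open>1, \<dots>, m\<close>. Thus the first case below is \<open>x\<^sub>m\<close> at position \<open>1\<close> and the second
  is \<open>x\<^sub>j\<close> at position \<open>j + 1\<close>.
\<close>

definition shift :: "'a ^ 'm::{finite,linorder} \<Rightarrow> 'a ^ 'm::{finite,linorder}"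
  where "shift x = (\<chi> i. if i = Min UNIV then x $ Max UNIV else x $ Max {j. j < i})"

definition diag :: "('a ^ 'm::finite) set"
  where "diag = {(\<chi> i. x) | x. True}"

definition op_prod :: "('m::finite \<Rightarrow> 'a setop) \<Rightarrow> ('a ^ 'm) setop"
  where "op_prod A = (\<lambda>x. {u. \<forall>i. u $ i \<in> A i (x $ i)})"

definition T_op :: "'a::real_vector ^ 'm::{finite,linorder} \<Rightarrow> 'a ^ 'm::{finite,linorder}"
  where "T_op x = (1 / (2 * real CARD('m))) *\<^sub>R
    (\<Sum>k = 1..CARD('m) - 1. (real CARD('m) - 2 * real k) *\<^sub>R (shift ^^ k) x)"

end

theory Submission
  imports Defs
begin

text \<open>
  Write \<open>R\<close> for the shift, \<open>D\<close> for the diagonal and \<open>T\<close> for \<open>T_op\<close>. Unfolding the definitions,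
  a primal solution is a point \<open>x\<close> with \<open>R x - x \<in> \<A> x\<close>, and a dual solution is a value \<open>R x - x\<close>
  attained at such an \<open>x\<close> (\<open>dsol_iff_displacement\<close>); so the dual solutions are exactly the image of
  the primal ones under \<open>R - Id\<close>.

  There is at most one of them. For a linear isometry, \<open>z \<bullet> (R z - z) = - \<parallel>R z - z\<parallel>\<^sup>2 / 2\<close>
  (\<open>inner_displacement\<close>). If \<open>x\<close>, \<open>x'\<close> are primal solutions and \<open>z = x - x'\<close>, monotonicity of \<open>\<A>\<close>
  makes the left-hand side nonnegative, hence \<open>R z = z\<close> and the two displacements agree
  (\<open>primal_displacement_unique\<close>).

  The formulas with \<open>T\<close> and the normal cone come from solving \<open>x - R x = y\<close> explicitly. The
  operator \<open>W = \<onehalf> Id + T\<close> is a weighted sum of the powers of \<open>R\<close>, and \<open>(Id - R) W\<close> telescopes to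
  \<open>Id\<close> minus the average of the powers of \<open>R\<close>; as \<open>R\<close> is cyclic, this average is the
  orthogonal projection onto \<open>D\<close>, the set of fixed points of \<open>R\<close>. Hence \<open>x - R x = y\<close> holds iff \<open>y \<in> D\<^sup>\<bottom>\<close> and
  \<open>x - W y \<in> D\<close> (\<open>displacement_eq_iff\<close>). Since \<open>D\<close> is also the normal cone of \<open>D\<^sup>\<bottom>\<close> at each of its points,
  the zeros of \<open>\<A>\<inverse> + N + \<onehalf> Id + T\<close>, the value at \<open>0\<close> of the resolvent (the same inclusion multiplied
  by \<open>2\<close>) and the set of \<open>y\<close> where \<open>\<A>\<inverse> y\<close> meets \<open>- (N y + \<onehalf> y + T y)\<close> all
  coincide with the set of dual solutions.
\<close>

section \<open>The cyclic shift\<close>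

text \<open>The shift reindexes a vector along the map sending each index to its cyclic predecessor.\<close>

definition cyc_pred :: "'m::{finite,linorder} \<Rightarrow> 'm"
  where "cyc_pred i = (if i = Min UNIV then Max UNIV else Max {j. j < i})"

definition position :: "'m::{finite,linorder} \<Rightarrow> nat"
  where "position i = card {j. j < i}"

lemma shift_nth: "shift x $ i = x $ cyc_pred i"
  by (simp add: shift_def cyc_pred_def)

lemma shift_funpow_nth: "(shift ^^ k) x $ i = x $ (cyc_pred ^^ k) i"
  by (induction k arbitrary: i) (simp_all add: shift_nth funpow_swap1[of cyc_pred])

lemma position_less: "position (i :: 'm::{finite,linorder}) < CARD('m)"
  unfolding position_def by (rule psubset_card_mono) auto

lemma position_strict_mono: "i < j \<Longrightarrow> position (i :: 'm::{finite,linorder}) < position j"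
  unfolding position_def by (rule psubset_card_mono) auto

lemma position_eq_iff: "position i = position j \<longleftrightarrow> i = j"
  by (metis position_strict_mono less_irrefl linorder_neqE)

text \<open>In terms of positions, the cyclic predecessor is subtraction of \<open>1\<close> modulo the number of indices;
  this reduces all orbit questions to modular arithmetic.\<close>

lemma position_cyc_pred:
  fixes i :: "'m::{finite,linorder}"
  shows "position i = (position (cyc_pred i) + 1) mod CARD('m)"
proof (cases "i = Min UNIV")
  case True
  have "{j. j < i} = {}"
    unfolding True by (auto simp: not_less)
  then have "position i = 0"
    by (simp add: position_def)
  moreover have "{j. j < Max UNIV} = UNIV - {Max UNIV :: 'm}"
    using Max_ge[OF finite_class.finite_UNIV] by (force simp: order.strict_iff_order)
  then have "position (cyc_pred i) = CARD('m) - 1"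
    using True by (simp add: position_def cyc_pred_def)
  ultimately show ?thesis
    using position_less[of i] by simp
next
  case False
  let ?p = "Max {j. j < i}"
  have ne: "{j. j < i} \<noteq> {}"
    using False Min_le[OF finite_class.finite_UNIV, of i]
    by (metis UNIV_I empty_Collect_eq order_le_imp_less_or_eq)
  have p: "?p < i"
    using Max_in[OF _ ne] by simp
  have "{j. j < i} = insert ?p {j. j < ?p}"
    using p Max_ge[of "{j. j < i}"] by (force simp: order.strict_iff_order)
  then have "position i = Suc (position ?p)"
    unfolding position_def by (metis card_insert_disjoint finite less_irrefl mem_Collect_eq)
  then show ?thesis
    using False position_less[of i] by (simp add: cyc_pred_def)
qed

lemma position_cyc_pred_funpow:
  fixes i :: "'m::{finite,linorder}"
  shows "position i = (position ((cyc_pred ^^ k) i) + k) mod CARD('m)"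
proof (induction k)
  case 0
  then show ?case using position_less[of i] by simp
next
  case (Suc k)
  have "position i = ((position (cyc_pred ((cyc_pred ^^ k) i)) + 1) mod CARD('m) + k) mod CARD('m)"
    using Suc position_cyc_pred[of "(cyc_pred ^^ k) i"] by simp
  then show ?case by (simp add: mod_add_left_eq)
qed

lemma cyc_pred_funpow_card: "(cyc_pred ^^ CARD('m)) (i :: 'm::{finite,linorder}) = i"
  using position_cyc_pred_funpow[of i "CARD('m)"] position_less[of "(cyc_pred ^^ CARD('m)) i"] by (simp flip: position_eq_iff)

lemma cyc_pred_transitive:
  fixes i :: "'m::{finite,linorder}"
  shows "(cyc_pred ^^ position i) i = Min UNIV"
proof -
  let ?j = "(cyc_pred ^^ position i) i"
  have "position ?j = 0"
  proof (rule ccontr)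
    assume nz: "position ?j \<noteq> 0"
    have eq: "position i = (position ?j + position i) mod CARD('m)"
      by (rule position_cyc_pred_funpow)
    show False
    proof (cases "position ?j + position i < CARD('m)")
      case True
      then show ?thesis using eq nz by simp
    next
      case False
      then have "(position ?j + position i) mod CARD('m) = position ?j + position i - CARD('m)"
        using position_less[of i] position_less[of ?j] by (simp add: le_mod_geq)
      then show ?thesis using eq False position_less[of ?j] by linarith
    qed
  qed
  then have "{j. j < ?j} = {}"
    by (simp add: position_def)
  then show ?thesis
    by (metis (mono_tags) Min_eqI UNIV_I empty_Collect_eq finite_class.finite_UNIV not_less)
qed

lemma bij_cyc_pred: "bij (cyc_pred :: 'm::{finite,linorder} \<Rightarrow> 'm)"
proof -
  have "surj (cyc_pred :: 'm \<Rightarrow> 'm)"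
  proof (rule surjI)
    fix i :: 'm
    have "CARD('m) = Suc (CARD('m) - 1)" by simp
    then show "cyc_pred ((cyc_pred ^^ (CARD('m) - 1)) i) = i"
      using cyc_pred_funpow_card[of i] by (metis comp_apply funpow.simps(2))
  qed
  then show ?thesis
    by (simp add: bij_def finite_UNIV_surj_inj)
qed

lemma linear_shift: "linear (shift :: 'a::real_vector ^ 'm::{finite,linorder} \<Rightarrow> _)"
  by (rule linearI) (simp_all add: vec_eq_iff shift_nth)

lemma shift_isometry:
  fixes x y :: "'a::real_inner ^ 'm::{finite,linorder}"
  shows "shift x \<bullet> shift y = x \<bullet> y"
  unfolding inner_vec_def shift_nth
  by (rule sum.reindex_bij_betw[OF bij_cyc_pred])

lemma shift_funpow_card: "(shift ^^ CARD('m)) x = (x :: 'a ^ 'm::{finite,linorder})"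
  by (simp add: vec_eq_iff shift_funpow_nth cyc_pred_funpow_card)

text \<open>Every index reaches the least one by iterating the cyclic predecessor, so a fixed vector has all
  its components equal to the first.\<close>

lemma shift_fixed_iff_diag: "shift x = x \<longleftrightarrow> x \<in> diag"
proof
  assume fixed: "shift x = x"
  have "(shift ^^ k) x = x" for k
    by (induction k) (simp_all add: fixed)
  then have "x $ i = x $ Min UNIV" for i
    by (metis shift_funpow_nth cyc_pred_transitive)
  then have "x = (\<chi> i. x $ Min UNIV)"
    by (simp add: vec_eq_iff)
  then show "x \<in> diag"
    unfolding diag_def by blast
qed (auto simp: diag_def vec_eq_iff shift_nth)

section \<open>Inverting the displacement operator\<close>

text \<open>Expanding the square of the norm of \<open>R z - z\<close>, the isometry property merges the two pure squares.\<close>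

lemma inner_displacement:
  fixes z :: "'a::real_inner ^ 'm::{finite,linorder}"
  shows "z \<bullet> (shift z - z) = - (norm (shift z - z))\<^sup>2 / 2"
  using shift_isometry[of z z] by (simp add: power2_norm_eq_inner inner_diff inner_commute field_simps)

lemma displacement_orthogonal:
  fixes x :: "'a::real_inner ^ 'm::{finite,linorder}"
  shows "x - shift x \<in> diag\<^sup>\<bottom>"
proof -
  have "d \<bullet> (x - shift x) = 0" if "d \<in> diag" for d
    using shift_isometry[of d x] that
    by (simp add: inner_diff_right flip: shift_fixed_iff_diag)
  then show ?thesis
    by (simp add: orthogonal_comp_def orthogonal_def)
qed

lemma diag_uminus: "- d \<in> diag \<longleftrightarrow> d \<in> (diag :: ('a::real_vector ^ 'm::{finite,linorder}) set)"
  by (simp add: linear_neg[OF linear_shift] flip: shift_fixed_iff_diag)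

lemma orthogonal_comp_uminus: "- y \<in> S\<^sup>\<bottom> \<longleftrightarrow> y \<in> S\<^sup>\<bottom>"
  by (simp add: orthogonal_comp_def orthogonal_def)

text \<open>Testing a normal vector \<open>u\<close> against the point \<open>y + (u - R u)\<close> gives \<open>(u - R u) \<bullet> u \<le> 0\<close>, which
  forces \<open>u\<close> to be fixed.\<close>

lemma normal_cone_diag_orthogonal:
  fixes y :: "'a::real_inner ^ 'm::{finite,linorder}"
  shows "normal_cone (diag\<^sup>\<bottom>) y = (if y \<in> diag\<^sup>\<bottom> then diag else {})"
proof -
  have "u \<in> diag" if y: "y \<in> diag\<^sup>\<bottom>" and le: "\<forall>c\<in>diag\<^sup>\<bottom>. (c - y) \<bullet> u \<le> 0" for u
  proof -
    have "y + (u - shift u) \<in> diag\<^sup>\<bottom>"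
      by (intro subspace_add[OF subspace_orthogonal_comp] y displacement_orthogonal)
    then have "(u - shift u) \<bullet> u \<le> 0"
      using le by force
    then have "0 \<le> u \<bullet> (shift u - u)"
      by (simp add: inner_diff inner_commute)
    then have "(norm (shift u - u))\<^sup>2 \<le> 0"
      using inner_displacement[of u] by linarith
    then show ?thesis
      by (simp flip: shift_fixed_iff_diag)
  qed
  moreover have "(c - y) \<bullet> u \<le> 0" if "y \<in> diag\<^sup>\<bottom>" "u \<in> diag" "c \<in> diag\<^sup>\<bottom>" for u c
  proof -
    have "u \<bullet> y = 0" "u \<bullet> c = 0"
      using that by (simp_all add: orthogonal_comp_def orthogonal_def)
    then show ?thesis
      by (simp add: inner_diff_right inner_commute[of _ u])
  qed
  ultimately show ?thesis
    by (auto simp: normal_cone_def)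
qed

lemma linear_shift_funpow:
  "linear ((shift :: 'a::real_vector ^ 'm::{finite,linorder} \<Rightarrow> _) ^^ k)"
  by (induction k) (simp_all add: linear_id[unfolded id_def] linear_compose[OF _ linear_shift, unfolded o_def])

lemma T_op_uminus: "T_op (- y) = - T_op y"
  by (simp add: T_op_def linear_neg[OF linear_shift_funpow] sum_negf)

lemma telescoping_weighted_sum:
  fixes f :: "nat \<Rightarrow> 'b::real_vector"
  shows "(\<Sum>k<n. (c - 2 * real k) *\<^sub>R (f k - f (Suc k)))
    = c *\<^sub>R f 0 - (c - 2 * real n) *\<^sub>R f n - 2 *\<^sub>R (\<Sum>k<n. f (Suc k))"
  by (induction n) (simp_all add: algebra_simps)

definition orbit_sum :: "'a::real_vector ^ 'm::{finite,linorder} \<Rightarrow> 'a ^ 'm::{finite,linorder}"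
  where "orbit_sum y = (\<Sum>k<CARD('m). (shift ^^ Suc k) y)"

lemma orbit_sum_in_diag:
  fixes y :: "'a::real_vector ^ 'm::{finite,linorder}"
  shows "orbit_sum y \<in> diag"
proof -
  let ?g = "\<lambda>k. (shift ^^ Suc k) y"
  have "shift (orbit_sum y) = (\<Sum>k<CARD('m). ?g (Suc k))"
    by (simp add: orbit_sum_def linear_sum[OF linear_shift])
  also have "\<dots> = (\<Sum>k<CARD('m). ?g k) + ?g CARD('m) - ?g 0"
    using sum.lessThan_Suc_shift[of ?g "CARD('m)"] sum.lessThan_Suc[of ?g "CARD('m)"]
    by (simp add: algebra_simps)
  also have "\<dots> = orbit_sum y"
    by (simp add: orbit_sum_def shift_funpow_card)
  finally show ?thesis
    by (simp add: shift_fixed_iff_diag)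
qed

text \<open>Up to the factor \<open>m\<close>, the orbit sum is the orthogonal projection onto the diagonal: pairing it
  with the fixed vector \<open>orbit_sum y\<close> itself, every summand contributes the same inner product
  with \<open>y\<close>.\<close>

lemma orbit_sum_orthogonal:
  fixes y :: "'a::real_inner ^ 'm::{finite,linorder}"
  assumes "y \<in> diag\<^sup>\<bottom>"
  shows "orbit_sum y = 0"
proof -
  let ?s = "orbit_sum y"
  have "?s \<bullet> (shift ^^ k) y = ?s \<bullet> y" for k
  proof (induction k)
    case (Suc k)
    then show ?case
      using shift_isometry[of ?s "(shift ^^ k) y"] orbit_sum_in_diag[of y]
      by (simp flip: shift_fixed_iff_diag)
  qed simp
  moreover have "?s \<bullet> y = 0"
    using assms orbit_sum_in_diag[of y] by (simp add: orthogonal_comp_def orthogonal_def)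
  ultimately have "?s \<bullet> (\<Sum>k<CARD('m). (shift ^^ Suc k) y) = 0"
    by (simp add: inner_sum_right del: funpow.simps)
  then have "?s \<bullet> ?s = 0"
    by (simp only: orbit_sum_def)
  then show ?thesis
    by simp
qed

text \<open>The identity \<open>(Id - R) (\<onehalf> Id + T) = Id - P\<close>, where \<open>P\<close> is the projection onto the diagonal.
  The term \<open>\<onehalf> Id\<close> is the summand \<open>k = 0\<close> missing from \<open>T\<close>.\<close>

lemma displacement_half_plus_T:
  fixes y :: "'a::real_vector ^ 'm::{finite,linorder}"
  defines "w \<equiv> (1/2) *\<^sub>R y + T_op y"
  shows "w - shift w = y - (1 / real CARD('m)) *\<^sub>R orbit_sum y"
proof -
  let ?m = "CARD('m)"
  let ?f = "\<lambda>k. (shift ^^ k) y"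
  have m: "real ?m \<noteq> 0" by simp
  have "{..<?m} = insert 0 {1..?m - 1}"
    by (auto simp: Suc_le_eq)
  then have "(\<Sum>k<?m. (real ?m - 2 * real k) *\<^sub>R ?f k)
      = real ?m *\<^sub>R y + (\<Sum>k=1..?m - 1. (real ?m - 2 * real k) *\<^sub>R ?f k)"
    by simp
  then have w: "w = (1 / (2 * real ?m)) *\<^sub>R (\<Sum>k<?m. (real ?m - 2 * real k) *\<^sub>R ?f k)"
    using m by (simp add: w_def T_op_def scaleR_add_right)
  have "w - shift w = (1 / (2 * real ?m)) *\<^sub>R
      (\<Sum>k<?m. (real ?m - 2 * real k) *\<^sub>R (?f k - ?f (Suc k)))"
    unfolding w
    by (simp add: linear_sum[OF linear_shift] linear_scale[OF linear_shift]
        scaleR_diff_right sum_subtractf)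
  also have "\<dots> = (1 / (2 * real ?m)) *\<^sub>R ((2 * real ?m) *\<^sub>R y - 2 *\<^sub>R orbit_sum y)"
    unfolding telescoping_weighted_sum[where f = ?f] orbit_sum_def
    by (simp add: shift_funpow_card del: funpow.simps(2) flip: scaleR_add_left)
  also have "\<dots> = y - (1 / real ?m) *\<^sub>R orbit_sum y"
    using m by (simp add: scaleR_diff_right)
  finally show ?thesis .
qed

text \<open>The set-valued formula \<open>(Id - R)\<inverse> = \<onehalf> Id + T + N\<close>: for \<open>y\<close> orthogonal to the diagonal,
  \<open>\<onehalf> y + T y\<close> is one solution of \<open>x - R x = y\<close>, and the others differ from it by fixed points of \<open>R\<close>.\<close>

lemma displacement_eq_iff:
  fixes x y :: "'a::real_inner ^ 'm::{finite,linorder}"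
  shows "x - shift x = y \<longleftrightarrow> y \<in> diag\<^sup>\<bottom> \<and> x - ((1/2) *\<^sub>R y + T_op y) \<in> diag"
proof (cases "y \<in> diag\<^sup>\<bottom>")
  case True
  define w where "w = (1/2) *\<^sub>R y + T_op y"
  have "w - shift w = y"
    using displacement_half_plus_T[of y] orbit_sum_orthogonal[OF True] by (simp add: w_def)
  then have "shift w = w - y"
    by (simp add: algebra_simps)
  then have "shift (x - w) - (x - w) = y - (x - shift x)"
    by (simp add: linear_diff[OF linear_shift])
  then have "x - shift x = y \<longleftrightarrow> shift (x - w) = x - w"
    by (metis eq_iff_diff_eq_0)
  then show ?thesis
    using True by (simp add: shift_fixed_iff_diag w_def)
next
  case False
  then show ?thesis
    using displacement_orthogonal[of x] by auto
qed

lemma displacement_eq_uminus_iff: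
  fixes x y :: "'a::real_inner ^ 'm::{finite,linorder}"
  shows "x - shift x = - y \<longleftrightarrow> y \<in> diag\<^sup>\<bottom> \<and> x + (1/2) *\<^sub>R y + T_op y \<in> diag"
proof -
  have "x - ((1/2) *\<^sub>R (- y) + T_op (- y)) = x + (1/2) *\<^sub>R y + T_op y"
    by (simp add: T_op_uminus)
  then show ?thesis
    by (simp only: displacement_eq_iff orthogonal_comp_uminus)
qed

section \<open>Primal and dual solutions\<close>

lemma mem_op_add: "z \<in> (A +\<^sub>o B) x \<longleftrightarrow> (\<exists>a\<in>A x. \<exists>b\<in>B x. z = a + b)"
  by (auto simp: op_add_def set_plus_def)

lemma mem_op_single: "z \<in> op_single f x \<longleftrightarrow> z = f x"
  by (simp add: op_single_def)

lemma mem_op_scale: "z \<in> (c *\<^sub>o A) x \<longleftrightarrow> (\<exists>a\<in>A x. z = c *\<^sub>R a)"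
  by (auto simp: op_scale_def)

lemma psol_iff_displacement:
  "x \<in> psol \<A> (op_single (\<lambda>x. x - shift x)) \<longleftrightarrow> shift x - x \<in> \<A> x"
  for \<A> :: "('a::real_vector ^ 'm::{finite,linorder}) setop"
proof -
  have "0 = a + (x - shift x) \<longleftrightarrow> a = shift x - x" for a
    by (auto simp: algebra_simps)
  then show ?thesis
    by (auto simp: psol_def op_add_def op_single_def set_plus_def)
qed

lemma dsol_iff_displacement:
  "y \<in> dsol \<A> (op_single (\<lambda>x. x - shift x)) \<longleftrightarrow> (\<exists>x. y \<in> \<A> x \<and> x - shift x = - y)"
  for \<A> :: "('a::real_vector ^ 'm::{finite,linorder}) setop"
proof -
  have "y \<in> dsol \<A> (op_single (\<lambda>x. x - shift x)) \<longleftrightarrow>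
      (\<exists>a b. y \<in> \<A> a \<and> - y = b - shift b \<and> 0 = a + - b)"
    unfolding dsol_def op_add_def op_single_def op_inv_def op_comp_def set_plus_def by blast
  also have "\<dots> \<longleftrightarrow> (\<exists>a b. y \<in> \<A> a \<and> - y = b - shift b \<and> a = b)"
    by (simp only: add_uminus_conv_diff eq_commute[of 0] right_minus_eq)
  finally show ?thesis
    by metis
qed

lemma dsol_orthogonal:
  fixes \<A> :: "('a::real_inner ^ 'm::{finite,linorder}) setop"
  assumes "y \<in> dsol \<A> (op_single (\<lambda>x. x - shift x))"
  shows "y \<in> diag\<^sup>\<bottom>"
proof -
  obtain x where "x - shift x = - y"
    using assms by (auto simp: dsol_iff_displacement)
  then show ?thesis
    using displacement_orthogonal[of x] orthogonal_comp_uminus by metis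
qed

text \<open>Monotonicity and the isometry give the number \<open>z \<bullet> (R z - z)\<close> opposite signs, where \<open>z\<close> is the
  difference of the two solutions.\<close>

lemma primal_displacement_unique:
  fixes \<A> :: "('a::real_inner ^ 'm::{finite,linorder}) setop"
  assumes "monotone_op \<A>" "shift x - x \<in> \<A> x" "shift x' - x' \<in> \<A> x'"
  shows "shift x - x = shift x' - x'"
proof -
  define z where "z = x - x'"
  have z: "shift z - z = (shift x - x) - (shift x' - x')"
    by (simp add: z_def linear_diff[OF linear_shift])
  have "0 \<le> z \<bullet> (shift z - z)"
    using assms unfolding z unfolding monotone_op_def z_def by blast
  then have "shift z - z = 0"
    by (simp add: inner_displacement)
  then show ?thesis
    by (simp add: z)
qed

text \<open>The common form to which the set of zeros, the resolvent and the intersection below all unfold. It is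
  the explicit solution of \<open>x - R x = - y\<close>: the normal vector \<open>n\<close> is the free diagonal component of
  that solution, negated, which is harmless since the diagonal is a subspace.\<close>

lemma dsol_iff_normal_cone:
  "y \<in> dsol \<A> (op_single (\<lambda>x. x - shift x)) \<longleftrightarrow>
    (\<exists>x n. y \<in> \<A> x \<and> n \<in> normal_cone (diag\<^sup>\<bottom>) y \<and> x + n + (1/2) *\<^sub>R y + T_op y = 0)"
  for \<A> :: "('a::real_inner ^ 'm::{finite,linorder}) setop"
proof -
  have "x - shift x = - y \<longleftrightarrow>
      (\<exists>n \<in> normal_cone (diag\<^sup>\<bottom>) y. x + n + (1/2) *\<^sub>R y + T_op y = 0)" for x
  proof -
    have "x - shift x = - y \<longleftrightarrow> y \<in> diag\<^sup>\<bottom> \<and> x + (1/2) *\<^sub>R y + T_op y \<in> diag"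
      by (rule displacement_eq_uminus_iff)
    also have "x + (1/2) *\<^sub>R y + T_op y \<in> diag \<longleftrightarrow>
        (\<exists>n \<in> diag. x + n + (1/2) *\<^sub>R y + T_op y = 0)"
    proof -
      have "x + n + (1/2) *\<^sub>R y + T_op y = 0 \<longleftrightarrow> n = - (x + (1/2) *\<^sub>R y + T_op y)" for n
        by (simp add: eq_neg_iff_add_eq_0 algebra_simps)
      then show ?thesis
        using diag_uminus[of "x + (1/2) *\<^sub>R y + T_op y"] by auto
    qed
    finally show ?thesis
      by (auto simp: normal_cone_diag_orthogonal)
  qed
  then show ?thesis
    unfolding dsol_iff_displacement by blast
qed

lemma dsol_eq_zer:
  "dsol \<A> (op_single (\<lambda>x. x - shift x)) =
    zer (op_inv \<A> +\<^sub>o normal_cone (diag\<^sup>\<bottom>) +\<^sub>o op_single (\<lambda>y. (1/2) *\<^sub>R y) +\<^sub>o op_single T_op)"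
  for \<A> :: "('a::real_inner ^ 'm::{finite,linorder}) setop"
proof (rule set_eqI)
  fix y :: "'a ^ 'm::{finite,linorder}"
  have "y \<in> zer (op_inv \<A> +\<^sub>o normal_cone (diag\<^sup>\<bottom>)
      +\<^sub>o op_single (\<lambda>y. (1/2) *\<^sub>R y) +\<^sub>o op_single T_op) \<longleftrightarrow>
      (\<exists>x n. y \<in> \<A> x \<and> n \<in> normal_cone (diag\<^sup>\<bottom>) y \<and> 0 = x + n + (1/2) *\<^sub>R y + T_op y)"
    unfolding zer_def op_inv_def mem_op_add mem_op_single mem_Collect_eq Bex_def by blast
  then show "y \<in> dsol \<A> (op_single (\<lambda>x. x - shift x)) \<longleftrightarrow> y \<in> zer (op_inv \<A> +\<^sub>o normal_cone (diag\<^sup>\<bottom>)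
      +\<^sub>o op_single (\<lambda>y. (1/2) *\<^sub>R y) +\<^sub>o op_single T_op)"
    by (simp only: dsol_iff_normal_cone eq_commute[of 0])
qed

lemma dsol_eq_resolvent:
  "dsol \<A> (op_single (\<lambda>x. x - shift x)) =
    resolvent (2 *\<^sub>o (op_inv \<A> +\<^sub>o normal_cone (diag\<^sup>\<bottom>) +\<^sub>o op_single T_op)) 0"
  for \<A> :: "('a::real_inner ^ 'm::{finite,linorder}) setop"
proof (rule set_eqI)
  fix y :: "'a ^ 'm::{finite,linorder}"
  have half: "0 = y + 2 *\<^sub>R (x + n + T_op y) \<longleftrightarrow> x + n + (1/2) *\<^sub>R y + T_op y = 0" for x n
  proof -
    have "y + 2 *\<^sub>R (x + n + T_op y) = 2 *\<^sub>R (x + n + (1/2) *\<^sub>R y + T_op y)"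
      by (simp add: scaleR_add_right)
    then show ?thesis
      by (simp only: eq_commute[of 0] scaleR_eq_0_iff) simp
  qed
  have "y \<in> resolvent (2 *\<^sub>o (op_inv \<A> +\<^sub>o normal_cone (diag\<^sup>\<bottom>) +\<^sub>o op_single T_op)) 0 \<longleftrightarrow>
      (\<exists>x n. y \<in> \<A> x \<and> n \<in> normal_cone (diag\<^sup>\<bottom>) y \<and> 0 = y + 2 *\<^sub>R (x + n + T_op y))"
    unfolding resolvent_def op_inv_def mem_op_add mem_op_single mem_op_scale mem_Collect_eq Bex_def id_def
    by blast
  then show "y \<in> dsol \<A> (op_single (\<lambda>x. x - shift x)) \<longleftrightarrow>
      y \<in> resolvent (2 *\<^sub>o (op_inv \<A> +\<^sub>o normal_cone (diag\<^sup>\<bottom>) +\<^sub>o op_single T_op)) 0"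
    unfolding dsol_iff_normal_cone half by (rule sym)
qed

lemma dsol_iff_intersection:
  "y \<in> dsol \<A> (op_single (\<lambda>x. x - shift x)) \<longleftrightarrow>
    op_inv \<A> y \<inter> uminus ` (normal_cone (diag\<^sup>\<bottom>) y + {(1/2) *\<^sub>R y} + {T_op y}) \<noteq> {}"
  for \<A> :: "('a::real_inner ^ 'm::{finite,linorder}) setop"
proof -
  have "x + n + (1/2) *\<^sub>R y + T_op y = 0 \<longleftrightarrow> x = - (n + (1/2) *\<^sub>R y + T_op y)" for x n
    by (simp only: eq_neg_iff_add_eq_0 add.assoc)
  then show ?thesis
    unfolding dsol_iff_normal_cone op_inv_def set_plus_def by blast
qed

lemma dsol_eq_displacement_image:
  "dsol \<A> (op_single (\<lambda>x. x - shift x)) =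
    (\<lambda>x. shift x - x) ` psol \<A> (op_single (\<lambda>x. x - shift x))"
  for \<A> :: "('a::real_vector ^ 'm::{finite,linorder}) setop"
proof -
  have "x - shift x = - y \<longleftrightarrow> y = shift x - x" for x y :: "'a ^ 'm::{finite,linorder}"
    by (metis minus_diff_eq minus_minus)
  moreover have "psol \<A> (op_single (\<lambda>x. x - shift x)) = {x. shift x - x \<in> \<A> x}"
    using psol_iff_displacement[of _ \<A>] by blast
  ultimately show ?thesis
    by (auto simp: dsol_iff_displacement)
qed

lemma dsol_subsingleton:
  fixes \<A> :: "('a::real_inner ^ 'm::{finite,linorder}) setop"
  assumes "monotone_op \<A>" "y \<in> dsol \<A> (op_single (\<lambda>x. x - shift x))"
  shows "dsol \<A> (op_single (\<lambda>x. x - shift x)) = {y}"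
proof -
  have "y' = y" if y': "y' \<in> dsol \<A> (op_single (\<lambda>x. x - shift x))" for y'
  proof -
    obtain x where "shift x - x \<in> \<A> x" "y = shift x - x"
      using assms(2) by (auto simp: dsol_eq_displacement_image psol_iff_displacement)
    moreover obtain x' where "shift x' - x' \<in> \<A> x'" "y' = shift x' - x'"
      using y' by (auto simp: dsol_eq_displacement_image psol_iff_displacement)
    ultimately show ?thesis
      using primal_displacement_unique[OF assms(1)] by simp
  qed
  then show ?thesis
    using assms(2) by blast
qed

text \<open>The displacement \<open>R x - x\<close> of a primal solution is a dual solution, hence equal to \<open>y\<close>. So the
  condition \<open>R x - x \<in> \<A> x\<close> splits into \<open>y \<in> \<A> x\<close> and the linear equation \<open>x - R x = - y\<close>,
  whose explicit solutions form the second set.\<close>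

lemma psol_from_dual_solution:
  fixes \<A> :: "('a::real_inner ^ 'm::{finite,linorder}) setop"
  assumes "dsol \<A> (op_single (\<lambda>x. x - shift x)) = {y}"
  shows "psol \<A> (op_single (\<lambda>x. x - shift x)) =
    op_inv \<A> y \<inter> {- (1/2) *\<^sub>R y - T_op y - d | d. d \<in> diag}"
proof (rule set_eqI)
  fix x
  have y: "y \<in> diag\<^sup>\<bottom>"
    using dsol_orthogonal[of y \<A>] assms by simp
  have "x \<in> psol \<A> (op_single (\<lambda>x. x - shift x)) \<longleftrightarrow> y \<in> \<A> x \<and> x - shift x = - y"
  proof -
    have "x - shift x = - y \<longleftrightarrow> shift x - x = y"
      by (metis minus_diff_eq minus_minus)
    moreover have "shift x - x = y" if "x \<in> psol \<A> (op_single (\<lambda>x. x - shift x))"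
      using that assms dsol_eq_displacement_image[of \<A>] by blast
    ultimately show ?thesis
      unfolding psol_iff_displacement by metis
  qed
  also have "x - shift x = - y \<longleftrightarrow> x + (1/2) *\<^sub>R y + T_op y \<in> diag"
    using y by (simp only: displacement_eq_uminus_iff simp_thms)
  also have "\<dots> \<longleftrightarrow> (\<exists>d \<in> diag. x = - (1/2) *\<^sub>R y - T_op y - d)"
  proof -
    have "x = - (1/2) *\<^sub>R y - T_op y - d \<longleftrightarrow> d = - (x + (1/2) *\<^sub>R y + T_op y)" for d
    proof -
      have "x - (- (1/2) *\<^sub>R y - T_op y - d) = d - - (x + (1/2) *\<^sub>R y + T_op y)"
        by (simp add: algebra_simps)
      then show ?thesis
        by (metis eq_iff_diff_eq_0)
    qed
    then show ?thesis
      using diag_uminus[of "x + (1/2) *\<^sub>R y + T_op y"] by auto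
  qed
  finally show "x \<in> psol \<A> (op_single (\<lambda>x. x - shift x)) \<longleftrightarrow>
      x \<in> op_inv \<A> y \<inter> {- (1/2) *\<^sub>R y - T_op y - d | d. d \<in> diag}"
    by (auto simp: op_inv_def)
qed

theorem theorem5p4:
  fixes A :: "'m::{finite,linorder} \<Rightarrow> 'a::{real_inner,complete_space} setop"
    and \<A> \<B> :: "('a ^ 'm::{finite,linorder}) setop"
    and Z :: "('a ^ 'm::{finite,linorder}) set"
  assumes m: "CARD('m) \<ge> 2"
    and A_maxmono: "\<And>i. maximally_monotone (A i)"
    and prod_def: "\<A> = op_prod A"
    and prod_maxmono: "maximally_monotone \<A>"
    and zer_ne: "zer \<A> \<noteq> {}"
    and Z_def: "Z = psol \<A> (op_single (\<lambda>x. x - shift x))"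
    and B_def: "\<B> = 2 *\<^sub>o (op_inv \<A> +\<^sub>o normal_cone (diag\<^sup>\<bottom>) +\<^sub>o op_single T_op)"
  shows "dsol \<A> (op_single (\<lambda>x. x - shift x)) =
      zer (op_inv \<A> +\<^sub>o normal_cone (diag\<^sup>\<bottom>) +\<^sub>o op_single (\<lambda>y. (1/2) *\<^sub>R y) +\<^sub>o op_single T_op)
    \<and> dsol \<A> (op_single (\<lambda>x. x - shift x)) = (\<lambda>x. shift x - x) ` Z
    \<and> (Z \<noteq> {} \<longrightarrow>
        (\<exists>y. resolvent \<B> 0 = {y} \<and> dsol \<A> (op_single (\<lambda>x. x - shift x)) = {y}))
    \<and> (Z = {} \<longrightarrow> dsol \<A> (op_single (\<lambda>x. x - shift x)) = {})
    \<and> (resolvent \<B> 0 \<noteq> {} \<longrightarrow>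
        (\<exists>ystar. resolvent \<B> 0 = {ystar}
          \<and> ystar \<in> diag\<^sup>\<bottom>
          \<and> (\<forall>y. op_inv \<A> y \<inter> uminus ` (normal_cone (diag\<^sup>\<bottom>) y + {(1/2) *\<^sub>R y} + {T_op y}) \<noteq> {}
                  \<longleftrightarrow> y = ystar)
          \<and> Z = op_inv \<A> ystar \<inter> {- (1/2) *\<^sub>R ystar - T_op ystar - d | d. d \<in> diag}))"
proof -
  let ?S = "dsol \<A> (op_single (\<lambda>x. x - shift x))"
  have mono: "monotone_op \<A>"
    using prod_maxmono by (simp add: maximally_monotone_def)
  have image: "?S = (\<lambda>x. shift x - x) ` Z"
    unfolding Z_def by (rule dsol_eq_displacement_image)
  have resolvent: "resolvent \<B> 0 = ?S"
    unfolding B_def by (rule dsol_eq_resolvent[symmetric])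
  have singleton: "\<exists>y. ?S = {y}" if "?S \<noteq> {}"
    using that dsol_subsingleton[OF mono] by blast
  have properties: "y \<in> diag\<^sup>\<bottom> \<and>
      (\<forall>y'. op_inv \<A> y' \<inter> uminus ` (normal_cone (diag\<^sup>\<bottom>) y' + {(1/2) *\<^sub>R y'} + {T_op y'}) \<noteq> {}
        \<longleftrightarrow> y' = y) \<and>
      Z = op_inv \<A> y \<inter> {- (1/2) *\<^sub>R y - T_op y - d | d. d \<in> diag}" if "?S = {y}" for y
  proof (intro conjI)
    show "y \<in> diag\<^sup>\<bottom>"
      using dsol_orthogonal[of y \<A>] that by simp
    show "\<forall>y'. op_inv \<A> y' \<inter> uminus ` (normal_cone (diag\<^sup>\<bottom>) y' + {(1/2) *\<^sub>R y'} + {T_op y'}) \<noteq> {}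
        \<longleftrightarrow> y' = y"
      unfolding dsol_iff_intersection[symmetric] that by simp
    show "Z = op_inv \<A> y \<inter> {- (1/2) *\<^sub>R y - T_op y - d | d. d \<in> diag}"
      unfolding Z_def by (rule psol_from_dual_solution[OF that])
  qed
  show ?thesis
    unfolding resolvent
  proof (intro conjI impI)
    assume "Z \<noteq> {}"
    then have "?S \<noteq> {}"
      unfolding image by simp
    then show "\<exists>y. ?S = {y} \<and> ?S = {y}"
      using singleton by simp
  next
    assume "Z = {}"
    then show "?S = {}"
      unfolding image by simp
  next
    assume "?S \<noteq> {}"
    then obtain y where "?S = {y}"
      using singleton by blast
    with properties[OF this]
    show "\<exists>ystar. ?S = {ystar} \<and> ystar \<in> diag\<^sup>\<bottom> \<and>
      (\<forall>y. op_inv \<A> y \<inter> uminus ` (normal_cone (diag\<^sup>\<bottom>) y + {(1/2) *\<^sub>R y} + {T_op y}) \<noteq> {}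
        \<longleftrightarrow> y = ystar) \<and>
      Z = op_inv \<A> ystar \<inter> {- (1/2) *\<^sub>R ystar - T_op ystar - d | d. d \<in> diag}"
      by (intro exI[of _ y] conjI) simp_all
  qed (fact dsol_eq_zer image)+
qed

end
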